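(* Let $K\ge 0$, $L\ge1$ be integers, $\lambda_1,\dots,\lambda_L\in\mathbb{C}$, and let $\mathcal{F}_{K,L}=\mathrm{span}\{x^k e^{\lambda_l x}: k=0,\dots,K,\ l=1,\dots,L\}$. Consider the modified two-derivative diagonally implicit Runge--Kutta method $$Y_i = y_n+\xi_i(\mu)c_{i} h f(y_n)+h^2\sum_{j=1}^{i} a_{ij}(\mu)g(Y_j),\ i=1,\ldots,s,\qquad y_{n+1} = y_n+h f(y_n)+h^2\sum_{i=1}^s b_i(\mu)g(Y_i),$$ and its associated operators $\mathcal{L}_i=\mathcal{L}_i[h,\bm{A},\bm{c},\bm{\xi}]$ and $\mathcal{L}=\mathcal{L}[h,\bm{b},\bm{c}]$. If $$\mathcal{L}_i\, y_m(0)=0\ (i=1,\dots,s),\qquad \mathcal{L}\, y_m(0)=0$$ for all $y_m(x)=x^m e^{\lambda_l x}$ with $m=0,1,\dots,K$ and $l=1,\dots,L$, then the method is an EFTDDIRK method of degree $(K,L)$. In particular, these fitting conditions take the following explicit form (for all $i=1,\dots,s$ and $l=1,\dots,L$): - Degree $(0,L)$ requires $$(\lambda_l h)^2\sum_{j=1}^{i}a_{ij}(\mu)e^{c_j\lambda_l h}+\xi_i(\mu)c_i\lambda_l h=e^{c_i\lambda_l h}-1,\qquad (\lambda_l h)^2\sum_{i=1}^{s}b_i(\mu)e^{c_i\lambda_l h}=e^{\lambda_l h}-1-\lambda_l h.$$ - Degree $(1,L)$ requires, in addition, $$\sum_{j=1}^{i}a_{ij}(\mu)\left[2\lambda_l h+c_j(\lambda_l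 h)^2\right]e^{c_j\lambda_l h}+\xi_i(\mu)c_i=c_ie^{c_i\lambda_l h},\qquad \sum_{i=1}^{s}b_i(\mu)\left[2\lambda_l h+c_i(\lambda_l h)^2\right]e^{c_i\lambda_l h}=e^{\lambda_l h}-1.$$ - Degree $(K,L)$ with $K\ge2$ requires, in addition to the two preceding sets of conditions, for each $k=2,\dots,K$, $$\sum_{j=1}^{i}a_{ij}(\mu)\left[k(k-1)c_j^{k-2}+2kc_j^{k-1}\lambda_l h+c_j^{k}(\lambda_l h)^2\right]e^{c_j\lambda_l h}=c_i^{k}e^{c_i\lambda_l h},$$ $$\sum_{i=1}^{s}b_i(\mu)\left[k(k-1)c_i^{k-2}+2kc_i^{k-1}\lambda_l h+c_i^{k}(\lambda_l h)^2\right]e^{c_i\lambda_l h}=e^{\lambda_l h}.$$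
   Context: Here $h>0$ is the stepsize, $\mu=\mathrm{i}\omega h$ with $\omega>0$ a frequency, $g(y)=f'(y)f(y)$, and the method is for $y'=f(y)$; $c_1,\dots,c_s$ are the nodes and $\xi_i(\mu),a_{ij}(\mu),b_i(\mu)$ the coefficients. Associated linear operators: $$\mathcal{L}_i[h,\bm{A},\bm{c},\bm{\xi}]y(x)=y(x+c_ih)-y(x)-\xi_i(\mu)c_ih\,y'(x)-h^2\sum_{j=1}^{i}a_{ij}(\mu)y''(x+c_jh),\quad i=1,\dots,s,$$ $$\mathcal{L}[h,\bm{b},\bm{c}]y(x)=y(x+h)-y(x)-h\,y'(x)-h^2\sum_{i=1}^{s}b_i(\mu)y''(x+c_ih).$$ The method is called an exponentially fitted TDDIRK (EFTDDIRK) method of degree $(K,L)$ if $\mathcal{L}[h,\bm{b},\bm{c}]y(x)\equiv0$ and $\mathcal{L}_i[h,\bm{A},\bm{c},\bm{\xi}]y(x)\equiv0$ ($i=1,\dots,s$) for all $y\in\mathcal{F}_{K,L}$. Convention $0^0=1$. *)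

theory Defs
  imports "HOL-Analysis.Analysis" "HOL-Library.Function_Algebras"
begin

text \<open>
  Coefficients of a modified two-derivative diagonally implicit Runge--Kutta method with
  stages and nodes indexed from 1. Apart from the nodes, the coefficients are functions of
  \<open>\<mu> = \<i>\<omega>h\<close>; methods with real coefficients are those whose values lie in \<open>\<real>\<close>.
\<close>

record tddirk =
  stages :: nat
  node :: "nat \<Rightarrow> real"
  xi :: "nat \<Rightarrow> complex \<Rightarrow> complex"
  acoeff :: "nat \<Rightarrow> nat \<Rightarrow> complex \<Rightarrow> complex"
  bcoeff :: "nat \<Rightarrow> complex \<Rightarrow> complex"

text \<open>
  One step of the method for \<open>y' = f(y)\<close> from \<open>y0\<close> to \<open>y1\<close> with internal stages \<open>Y\<close>. The stages are
  given implicitly, so a step is a relation. It fixes the role of the coefficients above;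
  exponential fitting only involves the associated operators below.
\<close>

definition second_deriv_field :: "(complex ^ 'd \<Rightarrow> complex ^ 'd) \<Rightarrow> complex ^ 'd \<Rightarrow> complex ^ 'd"
  where "second_deriv_field f y = frechet_derivative f (at y) (f y)"

definition tddirk_step ::
  "tddirk \<Rightarrow> real \<Rightarrow> complex \<Rightarrow> (complex ^ 'd \<Rightarrow> complex ^ 'd) \<Rightarrow>
   complex ^ 'd \<Rightarrow> (nat \<Rightarrow> complex ^ 'd) \<Rightarrow> complex ^ 'd \<Rightarrow> bool"
  where
  "tddirk_step M h \<mu> f y0 Y y1 \<longleftrightarrow>
     (\<forall>i\<in>{1..stages M}.
        Y i = y0 + (xi M i \<mu> * of_real (node M i) * of_real h) *s f y0
              + (of_real h)\<^sup>2 *s (\<Sum>j=1..i. acoeff M i j \<mu> *s second_deriv_field f (Y j))) \<and>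
     y1 = y0 + of_real h *s f y0
          + (of_real h)\<^sup>2 *s (\<Sum>i=1..stages M. bcoeff M i \<mu> *s second_deriv_field f (Y i))"

abbreviation D1 :: "(real \<Rightarrow> complex) \<Rightarrow> real \<Rightarrow> complex"
  where "D1 y \<equiv> (\<lambda>x. vector_derivative y (at x))"

abbreviation D2 :: "(real \<Rightarrow> complex) \<Rightarrow> real \<Rightarrow> complex"
  where "D2 y \<equiv> D1 (D1 y)"

definition stage_op ::
  "tddirk \<Rightarrow> real \<Rightarrow> complex \<Rightarrow> nat \<Rightarrow> (real \<Rightarrow> complex) \<Rightarrow> real \<Rightarrow> complex"
  where
  "stage_op M h \<mu> i y x =
     y (x + node M i * h) - y x - xi M i \<mu> * of_real (node M i) * of_real h * D1 y x
     - (of_real h)\<^sup>2 * (\<Sum>j=1..i. acoeff M i j \<mu> * D2 y (x + node M j * h))"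

definition update_op ::
  "tddirk \<Rightarrow> real \<Rightarrow> complex \<Rightarrow> (real \<Rightarrow> complex) \<Rightarrow> real \<Rightarrow> complex"
  where
  "update_op M h \<mu> y x =
     y (x + h) - y x - of_real h * D1 y x
     - (of_real h)\<^sup>2 * (\<Sum>i=1..stages M. bcoeff M i \<mu> * D2 y (x + node M i * h))"

text \<open>Complex-valued functions of a real variable as a vector space over \<open>\<complex>\<close>.\<close>

global_interpretation cfun: vector_space "\<lambda>(c::complex) (f::real \<Rightarrow> complex) x. c * f x"
  by unfold_locales (auto simp: fun_eq_iff algebra_simps)

definition exp_monom :: "complex \<Rightarrow> nat \<Rightarrow> real \<Rightarrow> complex"
  where "exp_monom w k x = of_real x ^ k * exp (w * of_real x)"

definition fitting_space :: "(nat \<Rightarrow> complex) \<Rightarrow> nat \<Rightarrow> nat \<Rightarrow> (real \<Rightarrow> complex) set"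
  where "fitting_space lam K L = cfun.span {exp_monom (lam l) k | k l. k \<in> {0..K} \<and> l \<in> {1..L}}"

definition EFTDDIRK ::
  "tddirk \<Rightarrow> real \<Rightarrow> complex \<Rightarrow> (nat \<Rightarrow> complex) \<Rightarrow> nat \<Rightarrow> nat \<Rightarrow> bool"
  where
  "EFTDDIRK M h \<mu> lam K L \<longleftrightarrow>
     (\<forall>y\<in>fitting_space lam K L.
        (\<forall>x. update_op M h \<mu> y x = 0) \<and>
        (\<forall>i\<in>{1..stages M}. \<forall>x. stage_op M h \<mu> i y x = 0))"

definition fitting_conditions ::
  "tddirk \<Rightarrow> real \<Rightarrow> complex \<Rightarrow> (nat \<Rightarrow> complex) \<Rightarrow> nat \<Rightarrow> nat \<Rightarrow> bool"
  where
  "fitting_conditions M h \<mu> lam K L \<longleftrightarrow>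
     (\<forall>m\<in>{0..K}. \<forall>l\<in>{1..L}.
        (\<forall>i\<in>{1..stages M}. stage_op M h \<mu> i (exp_monom (lam l) m) 0 = 0) \<and>
        update_op M h \<mu> (exp_monom (lam l) m) 0 = 0)"

text \<open>
  In the three explicit forms below, \<open>z\<close> is \<open>\<lambda>\<^sub>l h\<close>. Note that \<open>0 ^ 0 = 1\<close> in the
  library, so the factor \<open>c ^ (k - 2)\<close> is 1 for \<open>k = 2\<close> and a vanishing node.
\<close>

definition explicit0 :: "tddirk \<Rightarrow> complex \<Rightarrow> complex \<Rightarrow> bool"
  where
  "explicit0 M \<mu> z \<longleftrightarrow> (let c = (\<lambda>i. complex_of_real (node M i)) in
     (\<forall>i\<in>{1..stages M}.
        z\<^sup>2 * (\<Sum>j=1..i. acoeff M i j \<mu> * exp (c j * z)) + xi M i \<mu> * c i * z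
          = exp (c i * z) - 1) \<and>
     z\<^sup>2 * (\<Sum>i=1..stages M. bcoeff M i \<mu> * exp (c i * z)) = exp z - 1 - z)"

definition explicit1 :: "tddirk \<Rightarrow> complex \<Rightarrow> complex \<Rightarrow> bool"
  where
  "explicit1 M \<mu> z \<longleftrightarrow> (let c = (\<lambda>i. complex_of_real (node M i)) in
     (\<forall>i\<in>{1..stages M}.
        (\<Sum>j=1..i. acoeff M i j \<mu> * (2 * z + c j * z\<^sup>2) * exp (c j * z)) + xi M i \<mu> * c i
          = c i * exp (c i * z)) \<and>
     (\<Sum>i=1..stages M. bcoeff M i \<mu> * (2 * z + c i * z\<^sup>2) * exp (c i * z)) = exp z - 1)"

definition explicit_ge2 :: "tddirk \<Rightarrow> complex \<Rightarrow> nat \<Rightarrow> complex \<Rightarrow> bool"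
  where
  "explicit_ge2 M \<mu> k z \<longleftrightarrow> (let c = (\<lambda>i. complex_of_real (node M i)) in
     (\<forall>i\<in>{1..stages M}.
        (\<Sum>j=1..i. acoeff M i j \<mu> *
           (of_nat (k * (k - 1)) * c j ^ (k - 2) + 2 * of_nat k * c j ^ (k - 1) * z + c j ^ k * z\<^sup>2)
           * exp (c j * z))
          = c i ^ k * exp (c i * z)) \<and>
     (\<Sum>i=1..stages M. bcoeff M i \<mu> *
        (of_nat (k * (k - 1)) * c i ^ (k - 2) + 2 * of_nat k * c i ^ (k - 1) * z + c i ^ k * z\<^sup>2)
        * exp (c i * z))
       = exp z)"

end

theory Submission
  imports Defs
begin

text \<open>
  Stage and update operators are instances of one linear, translation-invariant operator.
  Translating \<open>x\<^sup>k e\<^bsup>wx\<^esup>\<close> yields a linear combination of the \<open>x\<^sup>j e\<^bsup>wx\<^esup>\<close> with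
  \<open>j \<le> k\<close>, so the kernel conditions at \<open>0\<close> propagate to every \<open>x\<close>, and by linearity to the span.
  The explicit forms are the values at \<open>0\<close>, up to the factor \<open>h\<^sup>k\<close>, which is nonzero.
\<close>

section \<open>A common form for the stage and update operators\<close>

definition fit_op ::
  "real \<Rightarrow> complex \<Rightarrow> nat set \<Rightarrow> (nat \<Rightarrow> complex) \<Rightarrow> (nat \<Rightarrow> real) \<Rightarrow> real \<Rightarrow>
   (real \<Rightarrow> complex) \<Rightarrow> real \<Rightarrow> complex"
  where
  "fit_op \<alpha> p J r c h y x =
     y (x + \<alpha> * h) - y x - p * of_real h * D1 y x
     - (of_real h)\<^sup>2 * (\<Sum>j\<in>J. r j * D2 y (x + c j * h))"

lemma stage_op_eq_fit_op:
  "stage_op M h \<mu> i =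
     fit_op (node M i) (xi M i \<mu> * of_real (node M i)) {1..i} (\<lambda>j. acoeff M i j \<mu>) (node M) h"
  by (simp add: fun_eq_iff stage_op_def fit_op_def)

lemma update_op_eq_fit_op:
  "update_op M h \<mu> = fit_op 1 1 {1..stages M} (\<lambda>j. bcoeff M j \<mu>) (node M) h"
  by (simp add: fun_eq_iff update_op_def fit_op_def)

section \<open>Linearity and translation invariance\<close>

text \<open>\<open>vector_derivative\<close> has an unspecified value where the derivative does not
  exist, so \<open>D1\<close> obeys the linear rules only on differentiable functions. Naming both
  derivatives lets these rules be applied without evaluating \<open>D2\<close>.\<close>

definition has_derivs :: "(real \<Rightarrow> complex) \<Rightarrow> (real \<Rightarrow> complex) \<Rightarrow> (real \<Rightarrow> complex) \<Rightarrow> bool"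
  where "has_derivs y y' y'' \<longleftrightarrow>
    (\<forall>x. (y has_vector_derivative y' x) (at x)) \<and> (\<forall>x. (y' has_vector_derivative y'' x) (at x))"

lemma fit_op_eq:
  assumes "has_derivs y y' y''"
  shows "fit_op \<alpha> p J r c h y x =
     y (x + \<alpha> * h) - y x - p * of_real h * y' x
     - (of_real h)\<^sup>2 * (\<Sum>j\<in>J. r j * y'' (x + c j * h))"
proof -
  have "vector_derivative y (at x) = y' x" "vector_derivative y' (at x) = y'' x" for x
    using assms by (auto simp: has_derivs_def intro: vector_derivative_at)
  then show ?thesis
    by (simp add: fit_op_def)
qed

lemma has_derivs_zero: "has_derivs 0 0 0"
  by (simp add: has_derivs_def zero_fun_def)

lemma has_derivs_add:
  assumes "has_derivs u u' u''" "has_derivs v v' v''"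
  shows "has_derivs (u + v) (u' + v') (u'' + v'')"
  using assms by (simp add: has_derivs_def plus_fun_def has_vector_derivative_add)

lemma has_derivs_scale:
  assumes "has_derivs u u' u''"
  shows "has_derivs (\<lambda>x. a * u x) (\<lambda>x. a * u' x) (\<lambda>x. a * u'' x)"
  using assms by (simp add: has_derivs_def has_vector_derivative_mult_right)

lemma has_derivs_shift:
  assumes "has_derivs y y' y''"
  shows "has_derivs (\<lambda>t. y (x + t)) (\<lambda>t. y' (x + t)) (\<lambda>t. y'' (x + t))"
proof -
  \<comment> \<open>Stated for a generic pair so that it serves twice: for \<open>y\<close> with
    \<open>y'\<close>, and for \<open>y'\<close> with \<open>y''\<close>.\<close>
  have "((\<lambda>t. g (x + t)) has_vector_derivative g' (x + t)) (at t)"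
    if "\<And>s. (g has_vector_derivative g' s) (at s)" for g g' :: "real \<Rightarrow> complex" and t
  proof -
    have "((\<lambda>t. x + t) has_vector_derivative 1) (at t)"
      by (auto intro!: derivative_eq_intros)
    from vector_diff_chain_at[OF this that] show ?thesis
      by (simp add: o_def)
  qed
  with assms show ?thesis
    by (simp add: has_derivs_def)
qed

lemma fit_op_shift:
  assumes "has_derivs y y' y''"
  shows "fit_op \<alpha> p J r c h (\<lambda>t. y (x + t)) 0 = fit_op \<alpha> p J r c h y x"
  by (simp add: fit_op_eq[OF assms] fit_op_eq[OF has_derivs_shift[OF assms]])

text \<open>Requiring two derivatives makes the operator linear, so its kernel is closed under the
  vector space operations. The kernel at 0 is used for translated monomials, the kernel at arbitrary
  \<open>x\<close> for the span.\<close>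

lemma subspace_fit_op_kernel:
  "cfun.subspace {y. (\<exists>y' y''. has_derivs y y' y'') \<and> fit_op \<alpha> p J r c h y x = 0}"
proof -
  have zero: "fit_op \<alpha> p J r c h 0 x = 0"
    by (simp add: fit_op_eq[OF has_derivs_zero])
  have add: "fit_op \<alpha> p J r c h (u + v) x = fit_op \<alpha> p J r c h u x + fit_op \<alpha> p J r c h v x"
    if "has_derivs u u' u''" "has_derivs v v' v''" for u u' u'' v v' v''
    by (simp add: fit_op_eq[OF that(1)] fit_op_eq[OF that(2)] fit_op_eq[OF has_derivs_add[OF that]]
        algebra_simps sum.distrib)
  have scale: "fit_op \<alpha> p J r c h (\<lambda>t. a * u t) x = a * fit_op \<alpha> p J r c h u x"
    if "has_derivs u u' u''" for a u u' u''
    by (simp add: fit_op_eq[OF that] fit_op_eq[OF has_derivs_scale[OF that]]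
        algebra_simps sum_distrib_left)
  show ?thesis
  proof (rule cfun.subspaceI)
    show "0 \<in> {y. (\<exists>y' y''. has_derivs y y' y'') \<and> fit_op \<alpha> p J r c h y x = 0}"
      using has_derivs_zero zero by auto
  next
    fix u v
    assume "u \<in> {y. (\<exists>y' y''. has_derivs y y' y'') \<and> fit_op \<alpha> p J r c h y x = 0}"
      and "v \<in> {y. (\<exists>y' y''. has_derivs y y' y'') \<and> fit_op \<alpha> p J r c h y x = 0}"
    then show "u + v \<in> {y. (\<exists>y' y''. has_derivs y y' y'') \<and> fit_op \<alpha> p J r c h y x = 0}"
      using has_derivs_add add by fastforce
  next
    fix a u
    assume "u \<in> {y. (\<exists>y' y''. has_derivs y y' y'') \<and> fit_op \<alpha> p J r c h y x = 0}"
    then show "(\<lambda>t. a * u t) \<in> {y. (\<exists>y' y''. has_derivs y y' y'') \<and> fit_op \<alpha> p J r c h y x = 0}"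
      using has_derivs_scale scale by fastforce
  qed
qed

section \<open>Derivatives and translates of exponential monomials\<close>

lemma exp_monom_has_vector_derivative:
  "(exp_monom w k has_vector_derivative
      of_nat k * exp_monom w (k - 1) x + w * exp_monom w k x) (at x)"
proof -
  \<comment> \<open>The complex derivative is restricted to the real line. For \<open>k = 0\<close>
    the truncated exponent \<open>k - 1\<close> is harmless, since the factor
    \<open>of_nat k\<close> vanishes.\<close>
  have "((\<lambda>z. z ^ k * exp (w * z)) has_field_derivative
      of_nat k * exp_monom w (k - 1) x + w * exp_monom w k x) (at (of_real x))"
    by (auto intro!: derivative_eq_intros simp: exp_monom_def algebra_simps)
  from has_vector_derivative_real_field[OF this] show ?thesis
    by (simp add: exp_monom_def[abs_def])
qed

lemma has_derivs_exp_monom: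
  "has_derivs (exp_monom w k)
    (\<lambda>x. of_nat k * exp_monom w (k - 1) x + w * exp_monom w k x)
    (\<lambda>x. of_nat (k * (k - 1)) * exp_monom w (k - 2) x
         + 2 * of_nat k * w * exp_monom w (k - 1) x + w\<^sup>2 * exp_monom w k x)"
proof -
  have "((\<lambda>x. of_nat k * exp_monom w (k - 1) x + w * exp_monom w k x) has_vector_derivative
      of_nat k * (of_nat (k - 1) * exp_monom w (k - 1 - 1) x + w * exp_monom w (k - 1) x)
      + w * (of_nat k * exp_monom w (k - 1) x + w * exp_monom w k x)) (at x)" for x
    by (intro has_vector_derivative_add has_vector_derivative_mult_right
        exp_monom_has_vector_derivative)
  moreover have
    "of_nat k * (of_nat (k - 1) * exp_monom w (k - 1 - 1) x + w * exp_monom w (k - 1) x)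
      + w * (of_nat k * exp_monom w (k - 1) x + w * exp_monom w k x) =
     of_nat (k * (k - 1)) * exp_monom w (k - 2) x
         + 2 * of_nat k * w * exp_monom w (k - 1) x + w\<^sup>2 * exp_monom w k x" for x
    \<comment> \<open>Merging \<open>k - 1 - 1\<close> into \<open>k - 2\<close> first gives both
      sides the same monomials; what remains is ring algebra.\<close>
    by (simp only: diff_diff_left one_add_one of_nat_mult) (simp add: field_simps power2_eq_square)
  ultimately show ?thesis
    unfolding has_derivs_def by (intro conjI allI exp_monom_has_vector_derivative) (simp only:)
qed

text \<open>Binomial theorem together with exp(w(x + t)) = exp(wx) exp(wt). The factors are grouped
  so that each coefficient is free of \<open>t\<close>.\<close>

lemma exp_monom_shift:
  "exp_monom w k (x + t) =
     (\<Sum>j\<le>k. (of_nat (k choose j) * of_real x ^ (k - j) * exp (w * of_real x)) * exp_monom w j t)"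
proof -
  have "exp_monom w k (x + t) =
      (of_real t + of_real x) ^ k * (exp (w * of_real x) * exp (w * of_real t))"
    by (simp add: exp_monom_def distrib_left exp_add add.commute)
  also have "\<dots> = (\<Sum>j\<le>k.
      (of_nat (k choose j) * of_real x ^ (k - j) * exp (w * of_real x)) * exp_monom w j t)"
    by (simp add: binomial_ring sum_distrib_left sum_distrib_right exp_monom_def mult_ac)
  finally show ?thesis .
qed

section \<open>From conditions at 0 to the whole fitting space\<close>

lemma sum_function_apply: "(\<Sum>j\<in>A. f j) x = (\<Sum>j\<in>A. (f j x :: complex))"
  by (induction A rule: infinite_finite_induct) auto

lemma fit_op_exp_monom_eq_0:
  assumes "\<And>j. j \<le> k \<Longrightarrow> fit_op \<alpha> p J r c h (exp_monom w j) 0 = 0"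
  shows "fit_op \<alpha> p J r c h (exp_monom w k) x = 0"
proof -
  let ?V = "{y. (\<exists>y' y''. has_derivs y y' y'') \<and> fit_op \<alpha> p J r c h y 0 = 0}"
  let ?a = "\<lambda>j. of_nat (k choose j) * of_real x ^ (k - j) * exp (w * of_real x)"
  \<comment> \<open>Here \<open>x\<close> is fixed and \<open>t\<close> is the variable, so the
    \<open>?a j\<close> are scalars and the kernel at 0 contains the sum once it contains every
    order \<open>j \<le> k\<close>.\<close>
  have "(\<lambda>t. exp_monom w k (x + t)) = (\<Sum>j\<le>k. (\<lambda>t. ?a j * exp_monom w j t))"
    by (rule ext) (simp only: sum_function_apply exp_monom_shift)
  also have "\<dots> \<in> ?V"
  proof (rule cfun.subspace_sum[OF subspace_fit_op_kernel])
    fix j assume "j \<in> {..k}"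
    then have "exp_monom w j \<in> ?V"
      using assms has_derivs_exp_monom by blast
    then show "(\<lambda>t. ?a j * exp_monom w j t) \<in> ?V"
      by (rule cfun.subspace_scale[OF subspace_fit_op_kernel])
  qed
  finally show ?thesis
    by (simp add: fit_op_shift[OF has_derivs_exp_monom])
qed

lemma fit_op_eq_0_on_fitting_space:
  assumes "\<And>m l. m \<le> K \<Longrightarrow> l \<in> {1..L} \<Longrightarrow> fit_op \<alpha> p J r c h (exp_monom (lam l) m) 0 = 0"
    and "y \<in> fitting_space lam K L"
  shows "fit_op \<alpha> p J r c h y x = 0"
proof -
  let ?B = "{exp_monom (lam l) k | k l. k \<in> {0..K} \<and> l \<in> {1..L}}"
  have "?B \<subseteq> {y. (\<exists>y' y''. has_derivs y y' y'') \<and> fit_op \<alpha> p J r c h y x = 0}"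
  proof clarify
    fix k l assume "k \<in> {0..K}" "l \<in> {1..L}"
    then have "fit_op \<alpha> p J r c h (exp_monom (lam l) k) x = 0"
      \<comment> \<open>All orders up to \<open>k\<close> are also at most \<open>K\<close>, so the
        assumption at 0 covers every term of the translate.\<close>
      by (auto intro: fit_op_exp_monom_eq_0[OF assms(1)])
    then show "(\<exists>y' y''. has_derivs (exp_monom (lam l) k) y' y'')
        \<and> fit_op \<alpha> p J r c h (exp_monom (lam l) k) x = 0"
      using has_derivs_exp_monom by blast
  qed
  then have "cfun.span ?B \<subseteq> {y. (\<exists>y' y''. has_derivs y y' y'') \<and> fit_op \<alpha> p J r c h y x = 0}"
    by (rule cfun.span_minimal[OF _ subspace_fit_op_kernel])
  then show ?thesis
    using assms(2) by (auto simp: fitting_space_def)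
qed

text \<open>Necessity holds because the generators lie in the space and 0 is one of the points; it
  is what justifies the word "requires" for the explicit forms.\<close>

lemma EFTDDIRK_iff_fitting_conditions:
  "EFTDDIRK M h \<mu> lam K L \<longleftrightarrow> fitting_conditions M h \<mu> lam K L"
proof
  assume "EFTDDIRK M h \<mu> lam K L"
  moreover have "exp_monom (lam l) m \<in> fitting_space lam K L"
    if "m \<in> {0..K}" "l \<in> {1..L}" for m l
    unfolding fitting_space_def using that by (intro cfun.span_base) blast
  ultimately show "fitting_conditions M h \<mu> lam K L"
    by (simp add: EFTDDIRK_def fitting_conditions_def)
next
  assume "fitting_conditions M h \<mu> lam K L"
  then show "EFTDDIRK M h \<mu> lam K L"
    unfolding EFTDDIRK_def fitting_conditions_def stage_op_eq_fit_op update_op_eq_fit_op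
    \<comment> \<open>Rotation puts the membership premise first for elimination; the conditions at
      0 are then left to \<open>simp\<close>.\<close>
    by (intro ballI conjI allI; elim fit_op_eq_0_on_fitting_space[rotated]; simp)
qed

section \<open>Values at 0 and the explicit equations\<close>

text \<open>Written in \<open>z\<close>, every term carries the factor h^k. The case distinction
  collects y(0) and p h y'(0), which vanish for \<open>k \<ge> 2\<close> because 0 is then a zero of
  order at least two.\<close>

lemma fit_op_exp_monom_at_0:
  fixes h :: real and w :: complex
  defines "z \<equiv> w * of_real h"
  shows "fit_op \<alpha> p J r c h (exp_monom w k) 0 =
    of_real h ^ k *
      (of_real \<alpha> ^ k * exp (of_real \<alpha> * z)
       - (if k = 0 then 1 + p * z else if k = 1 then p else 0)
       - (\<Sum>j\<in>J. r j *
            (of_nat (k * (k - 1)) * of_real (c j) ^ (k - 2)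
             + 2 * of_nat k * of_real (c j) ^ (k - 1) * z + of_real (c j) ^ k * z\<^sup>2)
            * exp (of_real (c j) * z)))"
proof -
  let ?y' = "\<lambda>x. of_nat k * exp_monom w (k - 1) x + w * exp_monom w k x"
  let ?y'' = "\<lambda>x. of_nat (k * (k - 1)) * exp_monom w (k - 2) x
         + 2 * of_nat k * w * exp_monom w (k - 1) x + w\<^sup>2 * exp_monom w k x"
  have y'': "(of_real h)\<^sup>2 * ?y'' (s * h) =
      of_real h ^ k * ((of_nat (k * (k - 1)) * of_real s ^ (k - 2)
             + 2 * of_nat k * of_real s ^ (k - 1) * z + of_real s ^ k * z\<^sup>2)
            * exp (of_real s * z))" for s
  proof -
    \<comment> \<open>The identities h^2 h^(k-2) = h^k and h h^(k-1) = h^k break down under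
      truncated subtraction for small \<open>k\<close>; there the factors \<open>k * (k - 1)\<close>
      and \<open>k\<close> are zero.\<close>
    consider "k = 0" | "k = 1" | n where "k = Suc (Suc n)"
      by (metis One_nat_def not0_implies_Suc)
    then show ?thesis
      by cases (simp_all add: exp_monom_def z_def power_mult_distrib power2_eq_square algebra_simps)
  qed
  have y': "of_real h * ?y' 0 = of_real h ^ k * (if k = 0 then z else if k = 1 then 1 else 0)"
    by (auto simp: exp_monom_def z_def power_0_left)
  have "fit_op \<alpha> p J r c h (exp_monom w k) 0 =
      exp_monom w k (\<alpha> * h) - exp_monom w k 0 - p * (of_real h * ?y' 0)
      - (\<Sum>j\<in>J. r j * ((of_real h)\<^sup>2 * ?y'' (c j * h)))"
    unfolding fit_op_eq[OF has_derivs_exp_monom] sum_distrib_left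
    by (simp add: mult.left_commute mult.assoc)
  also have "\<dots> = exp_monom w k (\<alpha> * h) - exp_monom w k 0
      - of_real h ^ k * (if k = 0 then p * z else if k = 1 then p else 0)
      - of_real h ^ k * (\<Sum>j\<in>J. r j *
            (of_nat (k * (k - 1)) * of_real (c j) ^ (k - 2)
             + 2 * of_nat k * of_real (c j) ^ (k - 1) * z + of_real (c j) ^ k * z\<^sup>2)
            * exp (of_real (c j) * z))"
    unfolding y' y'' by (simp add: sum_distrib_left mult.left_commute mult.assoc)
  also have "exp_monom w k (\<alpha> * h) = of_real h ^ k * (of_real \<alpha> ^ k * exp (of_real \<alpha> * z))"
    by (simp add: exp_monom_def z_def power_mult_distrib mult_ac)
  also have "exp_monom w k 0 = of_real h ^ k * (if k = 0 then 1 else 0)"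
    by (simp add: exp_monom_def)
  finally show ?thesis
    by (simp add: right_diff_distrib)
qed

lemma fit_op_exp_monom_0_iff:
  "fit_op \<alpha> p J r c h (exp_monom w 0) 0 = 0 \<longleftrightarrow>
    (w * of_real h)\<^sup>2 * (\<Sum>j\<in>J. r j * exp (of_real (c j) * (w * of_real h))) + p * (w * of_real h)
      = exp (of_real \<alpha> * (w * of_real h)) - 1"
  unfolding fit_op_exp_monom_at_0 by (auto simp: sum_distrib_left algebra_simps)

text \<open>The factor h^1 cancels, k(k - 1) is zero, and c^(k-1) is 1 even at a vanishing
  node.\<close>

lemma fit_op_exp_monom_1_iff:
  assumes "h \<noteq> 0"
  shows "fit_op \<alpha> p J r c h (exp_monom w 1) 0 = 0 \<longleftrightarrow>
    (\<Sum>j\<in>J. r j * (2 * (w * of_real h) + of_real (c j) * (w * of_real h)\<^sup>2)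
        * exp (of_real (c j) * (w * of_real h))) + p
      = of_real \<alpha> * exp (of_real \<alpha> * (w * of_real h))"
  unfolding fit_op_exp_monom_at_0 using assms by (auto simp: eq_diff_eq diff_eq_eq add.commute)

lemma fit_op_exp_monom_ge2_iff:
  assumes "h \<noteq> 0" "k \<ge> 2"
  shows "fit_op \<alpha> p J r c h (exp_monom w k) 0 = 0 \<longleftrightarrow>
    (\<Sum>j\<in>J. r j *
        (of_nat (k * (k - 1)) * of_real (c j) ^ (k - 2)
         + 2 * of_nat k * of_real (c j) ^ (k - 1) * (w * of_real h)
         + of_real (c j) ^ k * (w * of_real h)\<^sup>2)
        * exp (of_real (c j) * (w * of_real h)))
      = of_real \<alpha> ^ k * exp (of_real \<alpha> * (w * of_real h))"
  unfolding fit_op_exp_monom_at_0 using assms by auto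

section \<open>Assembling the conditions by order\<close>

text \<open>Isolates one monomial, so that each order can be matched with its explicit form before
  quantifying over orders and exponents.\<close>

definition fits_at_0 :: "tddirk \<Rightarrow> real \<Rightarrow> complex \<Rightarrow> complex \<Rightarrow> nat \<Rightarrow> bool"
  where "fits_at_0 M h \<mu> w k \<longleftrightarrow>
    (\<forall>i\<in>{1..stages M}. stage_op M h \<mu> i (exp_monom w k) 0 = 0) \<and>
    update_op M h \<mu> (exp_monom w k) 0 = 0"

text \<open>The update operator has \<open>p = 1\<close>, which puts an extra z on the left;
  \<open>eq_diff_eq\<close> reconciles this with the right-hand side e^z - 1 - z.\<close>

lemma fits_at_0_0_iff: "fits_at_0 M h \<mu> w 0 \<longleftrightarrow> explicit0 M \<mu> (w * of_real h)"
  by (simp add: fits_at_0_def explicit0_def stage_op_eq_fit_op update_op_eq_fit_op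
      fit_op_exp_monom_0_iff eq_diff_eq)

lemma fits_at_0_1_iff:
  assumes "h \<noteq> 0"
  shows "fits_at_0 M h \<mu> w 1 \<longleftrightarrow> explicit1 M \<mu> (w * of_real h)"
  unfolding fits_at_0_def explicit1_def stage_op_eq_fit_op update_op_eq_fit_op
    fit_op_exp_monom_1_iff[OF assms]
  by (simp add: eq_diff_eq)

lemma fits_at_0_ge2_iff:
  assumes "h \<noteq> 0" "k \<ge> 2"
  shows "fits_at_0 M h \<mu> w k \<longleftrightarrow> explicit_ge2 M \<mu> k (w * of_real h)"
  unfolding fits_at_0_def explicit_ge2_def stage_op_eq_fit_op update_op_eq_fit_op
    fit_op_exp_monom_ge2_iff[OF assms]
  by simp

lemma fitting_conditions_iff:
  "fitting_conditions M h \<mu> lam K L \<longleftrightarrow> (\<forall>l\<in>{1..L}. \<forall>k\<le>K. fits_at_0 M h \<mu> (lam l) k)"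
  by (auto simp: fitting_conditions_def fits_at_0_def)

lemma all_le_iff_split_0_1:
  fixes K :: nat
  assumes "K \<ge> 1"
  shows "(\<forall>k\<le>K. P k) \<longleftrightarrow> P 0 \<and> P 1 \<and> (\<forall>k\<in>{2..K}. P k)"
proof -
  have "{..K} = insert 0 (insert 1 {2..K})"
    using assms by auto
  then show ?thesis
    by (metis atMost_iff insert_iff)
qed

theorem theorem3p1:
  fixes M :: tddirk and h \<omega> :: real and \<mu> :: complex
    and K L :: nat and lam :: "nat \<Rightarrow> complex"
  assumes "h > 0" and "\<omega> > 0" and "\<mu> = \<i> * of_real \<omega> * of_real h" and "L \<ge> 1"
  shows "(fitting_conditions M h \<mu> lam K L \<longrightarrow> EFTDDIRK M h \<mu> lam K L)
    \<and> ((fitting_conditions M h \<mu> lam 0 L \<longleftrightarrow>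
          (\<forall>l\<in>{1..L}. explicit0 M \<mu> (lam l * of_real h)))
       \<and> (EFTDDIRK M h \<mu> lam 0 L \<longrightarrow>
          (\<forall>l\<in>{1..L}. explicit0 M \<mu> (lam l * of_real h))))
    \<and> ((fitting_conditions M h \<mu> lam 1 L \<longleftrightarrow>
          (\<forall>l\<in>{1..L}. explicit0 M \<mu> (lam l * of_real h) \<and> explicit1 M \<mu> (lam l * of_real h)))
       \<and> (EFTDDIRK M h \<mu> lam 1 L \<longrightarrow>
          (\<forall>l\<in>{1..L}. explicit0 M \<mu> (lam l * of_real h) \<and> explicit1 M \<mu> (lam l * of_real h))))
    \<and> (K \<ge> 2 \<longrightarrow>
       (fitting_conditions M h \<mu> lam K L \<longleftrightarrow>
          (\<forall>l\<in>{1..L}. explicit0 M \<mu> (lam l * of_real h) \<and> explicit1 M \<mu> (lam l * of_real h)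
             \<and> (\<forall>k\<in>{2..K}. explicit_ge2 M \<mu> k (lam l * of_real h))))
       \<and> (EFTDDIRK M h \<mu> lam K L \<longrightarrow>
          (\<forall>l\<in>{1..L}. explicit0 M \<mu> (lam l * of_real h) \<and> explicit1 M \<mu> (lam l * of_real h)
             \<and> (\<forall>k\<in>{2..K}. explicit_ge2 M \<mu> k (lam l * of_real h)))))"
proof -
  have h: "h \<noteq> 0" using \<open>h > 0\<close> by simp
  have 0: "fitting_conditions M h \<mu> lam 0 L \<longleftrightarrow>
      (\<forall>l\<in>{1..L}. explicit0 M \<mu> (lam l * of_real h))"
    by (simp add: fitting_conditions_iff fits_at_0_0_iff)
  \<comment> \<open>For \<open>K = 1\<close> the range \<open>{2..K}\<close> is empty, so one
    equivalence serves both degree 1 and the degrees from 2 on.\<close>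
  have ge1: "fitting_conditions M h \<mu> lam K L \<longleftrightarrow>
      (\<forall>l\<in>{1..L}. explicit0 M \<mu> (lam l * of_real h) \<and> explicit1 M \<mu> (lam l * of_real h)
         \<and> (\<forall>k\<in>{2..K}. explicit_ge2 M \<mu> k (lam l * of_real h)))" if "K \<ge> 1" for K
    unfolding fitting_conditions_iff all_le_iff_split_0_1[OF that] fits_at_0_0_iff
      fits_at_0_1_iff[OF h]
    by (auto simp: fits_at_0_ge2_iff[OF h])
  from 0 ge1[of 1] ge1[of K] show ?thesis
    \<comment> \<open>After this rewriting the sufficiency claim is trivial, and each "requires"
      clause is one direction of the equivalence beside it.\<close>
    unfolding EFTDDIRK_iff_fitting_conditions by simp
qed

end
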